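(* Let $n\ge 2$. For any dominant integral $\mathfrak{sl}_n$ weights $\lambda,\lambda'$ and any integers $M,M'\ge 0$ one has the Minkowski sum equalities $$S_{\lambda,M}+S_{\lambda',M'}=S_{\lambda+\lambda',M+M'}\quad\text{and}\quad X_{\lambda,M}+X_{\lambda',M'}=X_{\lambda+\lambda',M+M'}.$$
   Context: Let $P=\{(i,j): 1\le j<i\le n\}$ be the poset with $(i,j)\le(i_1,j_1)$ iff $i\le i_1$ and $j\le j_1$. For $d\in\{1,\dots,n-1\}$ let $P_d\subset P$ be the subposet of $(i,j)$ with $i>d\ge j$. For a finite poset $R$, $w(R)$ denotes its width (maximal size of an antichain; $w(\emptyset)=0$). A dominant integral weight is written $\lambda=\sum_{d=1}^{n-1}m_d\omega_d$ with $m_d\in\mathbb{Z}_{\ge0}$ and $\omega_d$ the fundamental weights. For an integer $M\ge0$, $X_{\lambda,M}\subset\mathbb{R}_{\ge0}^P$ is the polytope of points $(x_\alpha)_{\alpha\in P}$ with nonnegative coordinates satisfying, for every subset $P'\subset P$ (with the induced order), $$\sum_{\alpha\in P'}x_\alpha\le M+\sum_{d=1}^{n-1}m_d\,w(P'\cap P_d).$$ $S_{\lambda,M}=X_{\lambda,M}\cap\mathbb{Z}^P$ is its set of integer points. The sum of two subsets $A,B\subset\mathbb{R}^P$ is $A+B=\{a+b:a\in A,b\in B\}$. *)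

theory Defs
  imports
    Complex_Main
    "HOL-Library.Set_Algebras"
    "HOL-Library.Function_Algebras"
    "HOL-Library.Product_Order"
begin

definition antichain :: "'a::order set \<Rightarrow> bool"
  where "antichain A \<longleftrightarrow> (\<forall>a\<in>A. \<forall>b\<in>A. a \<le> b \<longrightarrow> a = b)"

text \<open>Only meaningful for finite posets \<open>R\<close>; the empty antichain gives width \<open>0\<close> when \<open>R\<close> is empty.\<close>

definition width :: "'a::order set \<Rightarrow> nat"
  where "width R = Max {card A | A. A \<subseteq> R \<and> antichain A}"

text \<open>The order on pairs is the componentwise one of \<open>HOL-Library.Product_Order\<close>.\<close>

definition root_poset :: "nat \<Rightarrow> (nat \<times> nat) set"
  where "root_poset n = {(i, j). 1 \<le> j \<and> j < i \<and> i \<le> n}"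

definition subposet :: "nat \<Rightarrow> nat \<Rightarrow> (nat \<times> nat) set"
  where "subposet n d = {(i, j) \<in> root_poset n. i > d \<and> d \<ge> j}"

text \<open>
  A dominant integral weight \<open>m\<^sub>1 \<omega>\<^sub>1 + \<dots> + m\<^sub>n\<^sub>-\<^sub>1 \<omega>\<^sub>n\<^sub>-\<^sub>1\<close> is represented by its
  coordinates \<open>d \<mapsto> m\<^sub>d\<close> in the basis of fundamental weights, set to \<open>0\<close> outside
  \<open>{1..n-1}\<close> so that the representation is unique; the sum of weights is the pointwise sum.
\<close>

type_synonym weight = "nat \<Rightarrow> nat"

definition dominant_weights :: "nat \<Rightarrow> weight set"
  where "dominant_weights n = {m. \<forall>d. d \<notin> {1..<n} \<longrightarrow> m d = 0}"

text \<open>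
  The space of real functions on \<open>P = root_poset n\<close> is represented by the functions on all
  pairs that vanish outside \<open>P\<close>, a subspace for the pointwise operations.
\<close>

definition coord_space :: "nat \<Rightarrow> (nat \<times> nat \<Rightarrow> real) set"
  where "coord_space n = {x. \<forall>\<alpha>. \<alpha> \<notin> root_poset n \<longrightarrow> x \<alpha> = 0}"

definition polytope_X :: "nat \<Rightarrow> weight \<Rightarrow> nat \<Rightarrow> (nat \<times> nat \<Rightarrow> real) set"
  where "polytope_X n m M = {x \<in> coord_space n.
    (\<forall>\<alpha>\<in>root_poset n. 0 \<le> x \<alpha>) \<and>
    (\<forall>P'. P' \<subseteq> root_poset n \<longrightarrow>
      (\<Sum>\<alpha>\<in>P'. x \<alpha>) \<le> real M + (\<Sum>d\<in>{1..<n}. real (m d) * real (width (P' \<inter> subposet n d))))}"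

definition integer_points_S :: "nat \<Rightarrow> weight \<Rightarrow> nat \<Rightarrow> (nat \<times> nat \<Rightarrow> real) set"
  where "integer_points_S n m M = {x \<in> polytope_X n m M. \<forall>\<alpha>\<in>root_poset n. x \<alpha> \<in> \<int>}"

end

theory Submission
  imports Defs
begin

text \<open>
  Each sum is contained in the right-hand side because the defining inequalities add up. The content is that an integer point \<open>x\<close> of the polytope for
  \<open>(\<lambda> + \<lambda>', M + M')\<close> splits; the statement for real points follows by splitting the integer
  parts of \<open>k x\<close>, rescaling by \<open>1 / k\<close> and passing to a limit.

  For an integer point, the idea is to remove at most \<open>M + M'\<close> units from \<open>x\<close> so that the rest is
  a sum of antichains, \<open>m\<^sub>d + m'\<^sub>d\<close> of them in each \<open>P\<^sub>d\<close>. The antichains are distributed among the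
  two summands according to \<open>m\<^sub>d\<close> and \<open>m'\<^sub>d\<close>, and the removed units according to \<open>M\<close> and \<open>M'\<close>. An
  antichain in \<open>P\<^sub>d\<close> meets \<open>P'\<close> in at most \<open>w(P' \<inter> P\<^sub>d)\<close> elements, so the two parts satisfy their
  inequalities.

  Such a family of antichains is encoded by a potential: integers \<open>p a\<close> and \<open>q a\<close> with \<open>q a \<le> p b\<close>
  whenever \<open>a < b\<close>. Write \<open>m\<^sub>d\<close> now for the coordinates of the sum of the two weights. The
  elements \<open>a\<close> with \<open>p a < t \<le> q a\<close> form an antichain for every level \<open>t\<close>, and \<open>a\<close> lies in \<open>max 0 (q a - p a)\<close> of them. If the interval of levels available to \<open>(i, j)\<close> runs from
  \<open>m\<^sub>1 + \<dots> + m\<^sub>j\<^sub>-\<^sub>1\<close> to \<open>m\<^sub>1 + \<dots> + m\<^sub>i\<^sub>-\<^sub>1\<close>, then the \<open>m\<^sub>d\<close> levels of the \<open>d\<close>-th block yield antichains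
  in \<open>P\<^sub>d\<close> (lemma \<open>level_antichains\<close>). Potentials with \<open>q a - p a \<le> x a\<close> and maximal total are dual
  to minimum cost covers of a subset \<open>U\<close> by chains, where \<open>x a\<close> is paid for every \<open>a\<close> outside \<open>U\<close>
  (lemma \<open>poset_potential_duality\<close>, obtained from the assignment problem). A chain costs \<open>m\<^sub>d\<close>
  for every \<open>d\<close> that it crosses, and a cover of \<open>U\<close> has at least \<open>w(U \<inter> P\<^sub>d)\<close> chains crossing \<open>d\<close>
  (lemma \<open>chain_cover_cost\<close>). Hence the inequality for \<open>P' = U\<close> shows that the total of the
  potential misses the total of \<open>x\<close> by at most the allowed number of units.
\<close>

section \<open>Integer duality for the assignment problem\<close>

text \<open>
  Halmos and Vaughan's induction: either some proper nonempty \<open>J\<close> is critical, and then \<open>J\<close> and its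
  complement can be matched separately, or all Hall inequalities for such \<open>J\<close> have slack and one
  arbitrary choice does no harm.
\<close>

lemma hall_marriage:
  fixes A :: "'i \<Rightarrow> 'b set"
  assumes "finite I" "\<And>i. i \<in> I \<Longrightarrow> finite (A i)"
    and "\<And>J. J \<subseteq> I \<Longrightarrow> card J \<le> card (\<Union>(A ` J))"
  shows "\<exists>f. inj_on f I \<and> (\<forall>i\<in>I. f i \<in> A i)"
  using assms
proof (induction I arbitrary: A rule: finite_psubset_induct)
  case (psubset I)
  note fin = psubset.prems(1) and hall = psubset.prems(2)
  have finU: "finite (\<Union>(A ` J))" if "J \<subseteq> I" for J
    using that fin psubset.hyps by (meson finite_UN_I finite_subset subsetD)
  show ?case
  proof (cases "I = {}")
    case True
    then show ?thesis by simp
  next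
    case nonempty: False
    show ?thesis
    proof (cases "\<exists>J. J \<subset> I \<and> J \<noteq> {} \<and> card (\<Union>(A ` J)) = card J")
      case True
      then obtain J where J: "J \<subset> I" "J \<noteq> {}" "card (\<Union>(A ` J)) = card J" by blast
      have "\<exists>f. inj_on f J \<and> (\<forall>i\<in>J. f i \<in> A i)"
        by (rule psubset.IH) (use J fin hall in auto)
      then obtain f where f: "inj_on f J" "\<forall>i\<in>J. f i \<in> A i" by blast
      define B where "B i = A i - \<Union>(A ` J)" for i
      have "\<exists>g. inj_on g (I - J) \<and> (\<forall>i\<in>I - J. g i \<in> B i)"
      proof (rule psubset.IH)
        show "I - J \<subset> I" using J by blast
        show "finite (B i)" if "i \<in> I - J" for i using that fin by (simp add: B_def)
        show "card K \<le> card (\<Union>(B ` K))" if K: "K \<subseteq> I - J" for K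
        proof -
          have fK: "finite K" "finite J"
            using K J psubset.hyps by (auto intro: finite_subset)
          have "card K + card J = card (K \<union> J)"
            using K fK by (subst card_Un_disjoint) auto
          also have "\<dots> \<le> card (\<Union>(A ` (K \<union> J)))" by (rule hall) (use K J in auto)
          finally have "card K + card J \<le> card (\<Union>(A ` (K \<union> J)))" .
          moreover have eq: "\<Union>(B ` K) = \<Union>(A ` (K \<union> J)) - \<Union>(A ` J)"
            by (auto simp: B_def)
          have "card (\<Union>(B ` K)) = card (\<Union>(A ` (K \<union> J))) - card (\<Union>(A ` J))"
            unfolding eq using J finU[of J] by (intro card_Diff_subset) auto
          ultimately show ?thesis using J(3) by linarith
        qed
      qed
      then obtain g where g: "inj_on g (I - J)" "\<forall>i\<in>I - J. g i \<in> B i" by blast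
      define h where "h i = (if i \<in> J then f i else g i)" for i
      have "inj_on h I"
      proof (rule inj_onI)
        fix a b assume ab: "a \<in> I" "b \<in> I" "h a = h b"
        show "a = b"
        proof (cases "a \<in> J"; cases "b \<in> J")
          assume "a \<in> J" "b \<in> J"
          then show ?thesis using ab f(1) by (auto simp: h_def inj_on_def)
        next
          assume "a \<in> J" "b \<notin> J"
          then have "f a = g b" "g b \<in> B b" "f a \<in> A a" using ab f(2) g(2) by (auto simp: h_def)
          then show ?thesis using \<open>a \<in> J\<close> by (auto simp: B_def)
        next
          assume "a \<notin> J" "b \<in> J"
          then have "g a = f b" using ab by (simp add: h_def)
          moreover have "g a \<in> B a" using ab g(2) \<open>a \<notin> J\<close> by blast
          moreover have "f b \<in> \<Union>(A ` J)" using \<open>b \<in> J\<close> f(2) by blast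
          then have "f b \<notin> B a" by (simp add: B_def)
          ultimately show ?thesis by simp
        next
          assume "a \<notin> J" "b \<notin> J"
          then show ?thesis using ab g(1) by (auto simp: h_def inj_on_def)
        qed
      qed
      moreover have "\<forall>i\<in>I. h i \<in> A i" using f g by (auto simp: h_def B_def)
      ultimately show ?thesis by blast
    next
      case False
      then have strict: "card K < card (\<Union>(A ` K))" if "K \<subset> I" "K \<noteq> {}" for K
        using hall[of K] that by (metis le_neq_implies_less psubset_imp_subset)
      obtain i where i: "i \<in> I" using nonempty by blast
      have "card {i} \<le> card (\<Union>(A ` {i}))" by (rule hall) (use i in auto)
      then obtain y where y: "y \<in> A i" by fastforce
      define B where "B j = A j - {y}" for j
      have "\<exists>g. inj_on g (I - {i}) \<and> (\<forall>j\<in>I - {i}. g j \<in> B j)"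
      proof (rule psubset.IH)
        show "I - {i} \<subset> I" using i by blast
        show "finite (B j)" if "j \<in> I - {i}" for j using that fin by (simp add: B_def)
        show "card K \<le> card (\<Union>(B ` K))" if K: "K \<subseteq> I - {i}" for K
        proof (cases "K = {}")
          case True
          then show ?thesis by simp
        next
          case False
          then have "card K < card (\<Union>(A ` K))" using K i by (intro strict) auto
          moreover have eq: "\<Union>(B ` K) = \<Union>(A ` K) - {y}" by (auto simp: B_def)
          have "card (\<Union>(A ` K)) - 1 \<le> card (\<Union>(B ` K))"
            unfolding eq by (simp add: card_Diff_singleton_if)
          ultimately show ?thesis by linarith
        qed
      qed
      then obtain g where g: "inj_on g (I - {i})" "\<forall>j\<in>I - {i}. g j \<in> B j" by blast
      have "inj_on (g(i := y)) I"
        using g by (auto simp: inj_on_def B_def)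
      moreover have "\<forall>j\<in>I. (g(i := y)) j \<in> A j" using g y by (auto simp: B_def)
      ultimately show ?thesis by blast
    qed
  qed
qed

text \<open>
  Egervary's theorem. An integer dual solution of maximal value exists because every perfect matching
  \<open>\<tau>\<close> bounds the value from above. Its tight edges satisfy Hall's condition: if \<open>J\<close> had fewer tight
  neighbours than elements, raising \<open>u\<close> by \<open>1\<close> on \<open>J\<close> and lowering \<open>v\<close> by \<open>1\<close> on the neighbours
  would increase the value, and integrality keeps the non-tight edges feasible. The set \<open>E\<close>
  consists of the edges of finite cost.
\<close>

lemma assignment_duality:
  fixes c :: "'l \<Rightarrow> 'r \<Rightarrow> int"
  assumes fin: "finite L" "finite R" and card: "card L = card R"
    and ex: "bij_betw \<tau> L R" "\<And>l. l \<in> L \<Longrightarrow> (l, \<tau> l) \<in> E"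
  obtains u v \<sigma> where "bij_betw \<sigma> L R"
    and "\<And>l. l \<in> L \<Longrightarrow> (l, \<sigma> l) \<in> E"
    and "\<And>l. l \<in> L \<Longrightarrow> u l + v (\<sigma> l) = c l (\<sigma> l)"
    and "\<And>l r. l \<in> L \<Longrightarrow> r \<in> R \<Longrightarrow> (l, r) \<in> E \<Longrightarrow> u l + v r \<le> c l r"
proof -
  define feasible where
    "feasible w \<longleftrightarrow> (\<forall>l\<in>L. \<forall>r\<in>R. (l, r) \<in> E \<longrightarrow> fst w l + snd w r \<le> c l r)"
    for w :: "('l \<Rightarrow> int) \<times> ('r \<Rightarrow> int)"
  define obj where "obj w = sum (fst w) L + sum (snd w) R"
    for w :: "('l \<Rightarrow> int) \<times> ('r \<Rightarrow> int)"
  define C where "C = (\<Sum>l\<in>L. c l (\<tau> l))"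
  have bound: "obj w \<le> C" if "feasible w" for w
  proof -
    have "obj w = (\<Sum>l\<in>L. fst w l + snd w (\<tau> l))"
      unfolding obj_def using sum.reindex_bij_betw[OF ex(1), of "snd w"]
      by (simp add: sum.distrib)
    also have "\<dots> \<le> C"
      unfolding C_def using that ex bij_betwE[OF ex(1)]
      by (intro sum_mono) (auto simp: feasible_def)
    finally show ?thesis .
  qed
  have "feasible (\<lambda>l. - (\<Sum>r\<in>R. \<bar>c l r\<bar>), \<lambda>r. 0)"
  proof -
    have "- (\<Sum>r\<in>R. \<bar>c l r\<bar>) \<le> c l r" if "r \<in> R" for l r
      using member_le_sum[of r R "\<lambda>r. \<bar>c l r\<bar>"] that fin by auto
    then show ?thesis by (simp add: feasible_def)
  qed
  then obtain w where w: "feasible w"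
    and least: "\<And>w'. feasible w' \<Longrightarrow> nat (C - obj w) \<le> nat (C - obj w')"
    using ex_has_least_nat[of feasible _ "\<lambda>w. nat (C - obj w)"] by metis
  have opt: "obj w' \<le> obj w" if "feasible w'" for w'
    using least[OF that] bound[OF that] bound[OF w] by linarith
  define u where "u = fst w"
  define v where "v = snd w"
  define N where "N l = {r \<in> R. (l, r) \<in> E \<and> u l + v r = c l r}" for l
  have "\<exists>f. inj_on f L \<and> (\<forall>l\<in>L. f l \<in> N l)"
  proof (rule hall_marriage)
    show "finite L" by (fact fin)
    show "finite (N l)" for l using fin by (simp add: N_def)
    show "card J \<le> card (\<Union>(N ` J))" if J: "J \<subseteq> L" for J
    proof (rule ccontr)
      assume less: "\<not> card J \<le> card (\<Union>(N ` J))"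
      let ?K = "\<Union>(N ` J)"
      have K: "?K \<subseteq> R" by (auto simp: N_def)
      define w' where "w' = (\<lambda>l. u l + (if l \<in> J then 1 else 0), \<lambda>r. v r - (if r \<in> ?K then 1 else 0))"
      have feas: "feasible w'"
        unfolding feasible_def
      proof (intro ballI impI)
        fix l r assume lr: "l \<in> L" "r \<in> R" "(l, r) \<in> E"
        have le: "u l + v r \<le> c l r" using w lr by (auto simp: feasible_def u_def v_def)
        have "l \<in> J \<Longrightarrow> r \<notin> ?K \<Longrightarrow> u l + v r \<noteq> c l r" using lr by (auto simp: N_def)
        then show "fst w' l + snd w' r \<le> c l r" using le by (auto simp: w'_def)
      qed
      have "sum (fst w') L = sum u L + int (card J)"
        using J fin by (simp add: w'_def sum.distrib sum.If_cases Int_absorb1)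
      moreover have "sum (snd w') R = sum v R - int (card ?K)"
      proof -
        have "R \<inter> ?K = ?K" using K by blast
        then have "(\<Sum>r\<in>R. if r \<in> ?K then 1 else 0) = int (card ?K)"
          using fin by (simp only: sum.If_cases[OF fin(2)] Collect_mem_eq) simp
        then show ?thesis by (simp add: w'_def sum_subtractf)
      qed
      ultimately have "obj w' > obj w" using less by (simp add: obj_def u_def v_def)
      then show False using opt[OF feas] by simp
    qed
  qed
  then obtain f where f: "inj_on f L" "\<forall>l\<in>L. f l \<in> N l" by blast
  have "f ` L = R"
    using f card fin by (intro card_subset_eq) (auto simp: card_image N_def)
  then have bij: "bij_betw f L R" using f by (simp add: bij_betw_def)
  show ?thesis
    by (rule that[of f u v]) (use bij f w in \<open>auto simp: N_def feasible_def u_def v_def\<close>)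
qed

section \<open>Potentials on a finite poset\<close>

text \<open>
  A partition of \<open>U\<close> into chains is recorded by its successor map \<open>s\<close>, the set \<open>E\<close> of tops and the
  set \<open>S\<close> of bottoms. It is viewed as a perfect matching between two copies of \<open>P\<close>: \<open>a\<close> is matched to
  itself at cost \<open>x a\<close> if it is left uncovered, to \<open>s a\<close> at cost \<open>0\<close>, or to a dummy vertex at cost
  \<open>hi a\<close> if it is a top; a bottom \<open>b\<close> is matched from a dummy vertex at cost \<open>- lo b\<close>. The dual
  variables of the two copies of \<open>a\<close> are \<open>q a\<close> and \<open>- p a\<close>, up to a common shift.
\<close>

lemma poset_potential_duality:
  fixes P :: "'a::order set" and x lo hi :: "'a \<Rightarrow> int"
  assumes fin: "finite P"
  obtains p q U E S s where
    "\<And>a. a \<in> P \<Longrightarrow> lo a \<le> p a" "\<And>a. a \<in> P \<Longrightarrow> q a \<le> hi a"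
    "\<And>a. a \<in> P \<Longrightarrow> q a - p a \<le> x a"
    "\<And>a b. a \<in> P \<Longrightarrow> b \<in> P \<Longrightarrow> a < b \<Longrightarrow> q a \<le> p b"
    "U \<subseteq> P" "E \<subseteq> U" "S \<subseteq> U" "bij_betw s (U - E) (U - S)"
    "\<And>a. a \<in> U - E \<Longrightarrow> a < s a"
    "sum x (P - U) + sum hi E - sum lo S \<le> (\<Sum>a\<in>P. q a - p a)"
proof -
  define N where "N = card P"
  \<comment> \<open>With one dummy more than there are elements, two dummies must be matched to each other.
    This pins down the shift \<open>V\<close> that normalises the dual variables of all dummies.\<close>
  define L :: "('a + nat) set" where "L = P <+> {..N}"
  define c :: "'a + nat \<Rightarrow> 'a + nat \<Rightarrow> int" where
    "c l r = (case l of
        Inl a \<Rightarrow> (case r of Inl b \<Rightarrow> if a = b then x a else 0 | Inr _ \<Rightarrow> hi a)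
      | Inr _ \<Rightarrow> (case r of Inl b \<Rightarrow> - lo b | Inr _ \<Rightarrow> 0))" for l r
  define G :: "(('a + nat) \<times> ('a + nat)) set" where
    "G = {(l, r). \<forall>a b. l = Inl a \<longrightarrow> r = Inl b \<longrightarrow> a \<le> b}"
  have finL: "finite L" using fin by (simp add: L_def)
  have id: "bij_betw id L L" by simp
  have idG: "(l, id l) \<in> G" for l by (auto simp: G_def)
  obtain u v \<sigma> where \<sigma>: "bij_betw \<sigma> L L"
    and \<sigma>G: "\<And>l. l \<in> L \<Longrightarrow> (l, \<sigma> l) \<in> G"
    and tight: "\<And>l. l \<in> L \<Longrightarrow> u l + v (\<sigma> l) = c l (\<sigma> l)"
    and feas: "\<And>l r. l \<in> L \<Longrightarrow> r \<in> L \<Longrightarrow> (l, r) \<in> G \<Longrightarrow> u l + v r \<le> c l r"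
    by (rule assignment_duality[OF finL finL refl id idG, of c]) (rule that; assumption)
  have mapsto: "\<sigma> l \<in> L" if "l \<in> L" for l using bij_betwE[OF \<sigma>] that by blast
  have inj: "l = l'" if "l \<in> L" "l' \<in> L" "\<sigma> l = \<sigma> l'" for l l'
    using bij_betw_imp_inj_on[OF \<sigma>] that by (auto dest: inj_onD)
  have surj: "\<exists>l\<in>L. \<sigma> l = r" if "r \<in> L" for r
    using bij_betw_imp_surj_on[OF \<sigma>] that by (metis imageE)
  have InlL [simp]: "Inl a \<in> L \<longleftrightarrow> a \<in> P" for a by (auto simp: L_def)
  have InrL [simp]: "Inr k \<in> L \<longleftrightarrow> k \<le> N" for k by (auto simp: L_def)
  have "\<exists>k\<le>N. \<exists>m\<le>N. \<sigma> (Inr k) = Inr m"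
  proof (rule ccontr)
    assume neg: "\<not> ?thesis"
    have "\<sigma> (Inr k) \<in> Inl ` P" if "k \<le> N" for k
      using neg mapsto[of "Inr k"] that by (cases "\<sigma> (Inr k)") auto
    then have "(\<lambda>k. \<sigma> (Inr k)) ` {..N} \<subseteq> Inl ` P" by auto
    then have "card ((\<lambda>k. \<sigma> (Inr k)) ` {..N}) \<le> card (Inl ` P :: ('a + nat) set)"
      using fin by (intro card_mono) auto
    moreover have "inj_on (\<lambda>k. \<sigma> (Inr k)) {..N}"
      proof (rule inj_onI)
      fix k m assume "k \<in> {..N}" "m \<in> {..N}" "\<sigma> (Inr k) = \<sigma> (Inr m)"
      then show "k = m" using inj[of "Inr k" "Inr m"] by simp
    qed
    ultimately show False by (simp add: card_image N_def)
  qed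
  then obtain k0 m0 where k0: "k0 \<le> N" "m0 \<le> N" "\<sigma> (Inr k0) = Inr m0" by blast
  define V where "V = v (Inr m0)"
  have uk0: "u (Inr k0) = - V" using tight[of "Inr k0"] k0 by (simp add: c_def V_def)
  have u_le: "u (Inr k) \<le> - V" if "k \<le> N" for k
    using feas[of "Inr k" "Inr m0"] that k0 by (simp add: c_def G_def V_def)
  have v_le: "v (Inr m) \<le> V" if "m \<le> N" for m
    using feas[of "Inr k0" "Inr m"] that k0 uk0 by (simp add: c_def G_def)
  define q where "q a = u (Inl a) + V" for a
  define p where "p a = V - v (Inl a)" for a
  define U where "U = {a \<in> P. \<sigma> (Inl a) \<noteq> Inl a}"
  define E where "E = {a \<in> P. \<sigma> (Inl a) \<in> range Inr}"
  define S where "S = {b \<in> P. \<forall>a\<in>P. \<sigma> (Inl a) \<noteq> Inl b}"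
  define s where "s a = projl (\<sigma> (Inl a))" for a
  define K where "K = {k. k \<le> N \<and> \<sigma> (Inr k) \<in> range Inl}"
  have sumL: "(\<Sum>l\<in>L. f l) = (\<Sum>a\<in>P. f (Inl a)) + (\<Sum>k\<le>N. f (Inr k))"
    for f :: "'a + nat \<Rightarrow> int"
    unfolding L_def using fin by (subst sum.Plus) auto
  have s: "\<sigma> (Inl a) = Inl (s a)" "s a \<in> P" "a < s a" "s a \<notin> S" "s a \<in> U" if "a \<in> U - E" for a
  proof -
    have aP: "a \<in> P" and ne: "\<sigma> (Inl a) \<noteq> Inl a" and "\<sigma> (Inl a) \<notin> range Inr"
      using that by (auto simp: U_def E_def)
    then show eq: "\<sigma> (Inl a) = Inl (s a)" by (cases "\<sigma> (Inl a)") (auto simp: s_def)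
    show sP: "s a \<in> P" using mapsto[of "Inl a"] aP eq by simp
    have "a \<le> s a" using \<sigma>G[of "Inl a"] aP eq by (simp add: G_def)
    then show "a < s a" using ne eq by (simp add: order_less_le)
    show "s a \<notin> S" using aP eq by (auto simp: S_def)
    show "s a \<in> U" using inj[of "Inl a" "Inl (s a)"] aP sP eq ne by (auto simp: U_def)
  qed
  have bij_s: "bij_betw s (U - E) (U - S)"
  proof (rule bij_betw_imageI)
    show "inj_on s (U - E)"
    proof (rule inj_onI)
      fix a b assume ab: "a \<in> U - E" "b \<in> U - E" "s a = s b"
      then have "\<sigma> (Inl a) = \<sigma> (Inl b)" using s(1) by metis
      then show "a = b" using inj[of "Inl a" "Inl b"] ab by (auto simp: U_def)
    qed
    show "s ` (U - E) = U - S"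
    proof
      show "s ` (U - E) \<subseteq> U - S" using s by auto
      show "U - S \<subseteq> s ` (U - E)"
      proof
        fix b assume b: "b \<in> U - S"
        then obtain a where a: "a \<in> P" "\<sigma> (Inl a) = Inl b" by (auto simp: U_def S_def)
        then have "a \<in> U - E" using b by (auto simp: U_def E_def)
        moreover have "s a = b" using a by (simp add: s_def)
        ultimately show "b \<in> s ` (U - E)" by blast
      qed
    qed
  qed
  have "(\<Sum>a\<in>P. c (Inl a) (\<sigma> (Inl a))) = sum x (P - U) + sum hi E"
  proof -
    have EU: "E \<subseteq> U" "U \<subseteq> P" by (auto simp: E_def U_def)
    have "(\<Sum>a\<in>P. c (Inl a) (\<sigma> (Inl a)))
        = (\<Sum>a\<in>P - U. c (Inl a) (\<sigma> (Inl a))) + (\<Sum>a\<in>U. c (Inl a) (\<sigma> (Inl a)))"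
      using EU fin by (intro sum.subset_diff)
    also have "(\<Sum>a\<in>U. c (Inl a) (\<sigma> (Inl a)))
        = (\<Sum>a\<in>U - E. c (Inl a) (\<sigma> (Inl a))) + (\<Sum>a\<in>E. c (Inl a) (\<sigma> (Inl a)))"
      using EU fin by (intro sum.subset_diff) (auto intro: finite_subset)
    also have "(\<Sum>a\<in>P - U. c (Inl a) (\<sigma> (Inl a))) = sum x (P - U)"
      by (rule sum.cong) (auto simp: U_def c_def)
    also have "(\<Sum>a\<in>U - E. c (Inl a) (\<sigma> (Inl a))) = 0"
    proof (intro sum.neutral ballI)
      fix a assume "a \<in> U - E"
      then show "c (Inl a) (\<sigma> (Inl a)) = 0" using s(1,3)[of a] by (auto simp: c_def)
    qed
    also have "(\<Sum>a\<in>E. c (Inl a) (\<sigma> (Inl a))) = sum hi E"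
      by (rule sum.cong) (auto simp: E_def c_def)
    finally show ?thesis by simp
  qed
  moreover have "(\<Sum>k\<le>N. c (Inr k) (\<sigma> (Inr k))) = - sum lo S"
  proof -
    have "(\<Sum>k\<le>N. c (Inr k) (\<sigma> (Inr k))) = (\<Sum>k\<in>K. c (Inr k) (\<sigma> (Inr k)))"
    proof (rule sum.mono_neutral_right)
      show "\<forall>k\<in>{..N} - K. c (Inr k) (\<sigma> (Inr k)) = 0"
      proof
        fix k assume "k \<in> {..N} - K"
        then show "c (Inr k) (\<sigma> (Inr k)) = 0"
          by (cases "\<sigma> (Inr k)") (auto simp: K_def c_def)
      qed
    qed (auto simp: K_def)
    also have "\<dots> = (\<Sum>k\<in>K. - lo (projl (\<sigma> (Inr k))))"
      by (rule sum.cong) (auto simp: K_def c_def)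
    also have "\<dots> = (\<Sum>b\<in>S. - lo b)"
    proof (rule sum.reindex_bij_betw, rule bij_betw_imageI)
      show "inj_on (\<lambda>k. projl (\<sigma> (Inr k))) K"
      proof (rule inj_onI)
        fix k m assume km: "k \<in> K" "m \<in> K" "projl (\<sigma> (Inr k)) = projl (\<sigma> (Inr m))"
        then have "\<sigma> (Inr k) = \<sigma> (Inr m)" by (auto simp: K_def)
        then show "k = m" using inj[of "Inr k" "Inr m"] km by (auto simp: K_def)
      qed
      show "(\<lambda>k. projl (\<sigma> (Inr k))) ` K = S"
      proof
        show "(\<lambda>k. projl (\<sigma> (Inr k))) ` K \<subseteq> S"
        proof
          fix b assume "b \<in> (\<lambda>k. projl (\<sigma> (Inr k))) ` K"
          then obtain k where k: "k \<le> N" "\<sigma> (Inr k) = Inl b" by (auto simp: K_def)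
          then have "b \<in> P" using mapsto[of "Inr k"] by simp
          moreover have "\<sigma> (Inl a) \<noteq> Inl b" if "a \<in> P" for a
            using inj[of "Inl a" "Inr k"] k that by auto
          ultimately show "b \<in> S" by (auto simp: S_def)
        qed
        show "S \<subseteq> (\<lambda>k. projl (\<sigma> (Inr k))) ` K"
        proof
          fix b assume b: "b \<in> S"
          then obtain l where l: "l \<in> L" "\<sigma> l = Inl b" using surj[of "Inl b"] by (auto simp: S_def)
          then obtain k where "l = Inr k" using b by (cases l) (auto simp: S_def)
          then show "b \<in> (\<lambda>k. projl (\<sigma> (Inr k))) ` K"
            using l by (intro image_eqI[of _ _ k]) (auto simp: K_def)
        qed
      qed
    qed
    finally show ?thesis by (simp add: sum_negf)
  qed
  ultimately have cost: "(\<Sum>l\<in>L. c l (\<sigma> l)) = sum x (P - U) + sum hi E - sum lo S"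
    by (simp add: sumL)
  have "(\<Sum>l\<in>L. c l (\<sigma> l)) = (\<Sum>l\<in>L. u l + v (\<sigma> l))" by (simp add: tight)
  also have "\<dots> = sum u L + sum v L"
    using sum.reindex_bij_betw[OF \<sigma>, of v] by (simp add: sum.distrib)
  also have "\<dots> \<le> (\<Sum>a\<in>P. u (Inl a)) + (\<Sum>k\<le>N. - V) + ((\<Sum>a\<in>P. v (Inl a)) + (\<Sum>k\<le>N. V))"
    unfolding sumL by (intro add_mono sum_mono order_refl) (auto simp: u_le v_le)
  also have "\<dots> = (\<Sum>a\<in>P. q a - p a)"
    by (simp add: q_def p_def sum.distrib)
  finally have obj: "sum x (P - U) + sum hi E - sum lo S \<le> (\<Sum>a\<in>P. q a - p a)"
    using cost by simp
  show ?thesis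
  proof (rule that[of p q U E S s])
    show "lo a \<le> p a" if "a \<in> P" for a
      using feas[of "Inr k0" "Inl a"] that k0 uk0 by (simp add: c_def G_def p_def)
    show "q a \<le> hi a" if "a \<in> P" for a
      using feas[of "Inl a" "Inr m0"] that k0 by (simp add: c_def G_def q_def V_def)
    show "q a - p a \<le> x a" if "a \<in> P" for a
      using feas[of "Inl a" "Inl a"] that by (simp add: c_def G_def q_def p_def)
    show "q a \<le> p b" if "a \<in> P" "b \<in> P" "a < b" for a b
      using feas[of "Inl a" "Inl b"] that less_imp_le[OF that(3)] less_imp_neq[OF that(3)]
      by (simp add: c_def G_def q_def p_def)
    show "U \<subseteq> P" by (auto simp: U_def)
    show "E \<subseteq> U" by (auto simp: U_def E_def)
    show "S \<subseteq> U" by (auto simp: U_def S_def)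
  qed (use bij_s s obj in auto)
qed

section \<open>Widths and chain covers\<close>

lemma finite_root_poset [simp]: "finite (root_poset n)"
  by (rule finite_subset[of _ "{..n} \<times> {..n}"]) (auto simp: root_poset_def)

lemma finite_antichain_cards:
  "finite R \<Longrightarrow> finite {card A | A. A \<subseteq> R \<and> antichain A}"
  by (rule finite_subset[of _ "card ` Pow R"]) auto

lemma card_antichain_le_width:
  assumes "finite R" "A \<subseteq> R" "antichain A"
  shows "card A \<le> width R"
  unfolding width_def using assms finite_antichain_cards by (intro Max_ge) auto

lemma width_attained:
  assumes "finite R"
  obtains A where "A \<subseteq> R" "antichain A" "card A = width R"
proof -
  have "card {} \<in> {card A | A. A \<subseteq> R \<and> antichain A}"
    by (rule CollectI, rule exI[of _ "{}"]) (auto simp: antichain_def)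
  then have "width R \<in> {card A | A. A \<subseteq> R \<and> antichain A}"
    unfolding width_def using finite_antichain_cards[OF assms] by (intro Max_in) auto
  then show ?thesis using that by auto
qed

text \<open>
  Every element of \<open>A\<close> lies on a different chain of the cover, and this chain crosses \<open>d\<close>: it starts
  with second coordinate at most \<open>d\<close> and ends with first coordinate above \<open>d\<close>. Chains with all
  second coordinates above \<open>d\<close> also have their tops counted on the right, which accounts for the
  second summand. The proof counts across a cut instead of following chains. Let
  \<open>W\<close> be the up-set in \<open>U\<close> generated by \<open>A\<close> and by the elements with second coordinate above \<open>d\<close>. The
  successor map sends the non-tops of \<open>W\<close> injectively into \<open>W\<close>, and it misses \<open>A\<close>, whose
  elements are minimal in \<open>W\<close>, as well as the bottoms. So \<open>W\<close> contains enough tops.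
\<close>

lemma antichain_cut:
  assumes U: "U \<subseteq> root_poset n" "E \<subseteq> U" "S \<subseteq> U"
    and s: "bij_betw s (U - E) (U - S)" "\<And>a. a \<in> U - E \<Longrightarrow> a < s a"
    and A: "A \<subseteq> U \<inter> subposet n d" "antichain A"
  shows "card A + card {b \<in> S. d < snd b} \<le> card {a \<in> E. d < fst a}"
proof -
  have finU: "finite U" using U(1) finite_root_poset by (rule finite_subset)
  define J where "J = {a \<in> U. d < snd a}"
  define W where "W = {a \<in> U. \<exists>a0\<in>A. a0 \<le> a} \<union> J"
  have WU: "W \<subseteq> U" by (auto simp: W_def J_def)
  have finW: "finite W" using WU finU by (rule finite_subset)
  have A_mem: "a \<in> U" "d < fst a" "snd a \<le> d" if "a \<in> A" for a
    using A that by (auto simp: subposet_def)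
  have up: "b \<in> W" if "a \<in> W" "b \<in> U" "a \<le> b" for a b
    using that unfolding W_def J_def by (auto simp: less_eq_prod_def intro: order_trans)
  have W_fst: "d < fst a" if a: "a \<in> W" for a
  proof -
    consider a0 where "a0 \<in> A" "a0 \<le> a" | "a \<in> J" using a unfolding W_def by blast
    then show ?thesis
    proof cases
      case 1
      then show ?thesis using A_mem[of a0] by (auto simp: less_eq_prod_def)
    next
      case 2
      then show ?thesis using U(1) by (auto simp: J_def root_poset_def)
    qed
  qed
  have maps: "s a \<in> W - (A \<union> (J \<inter> S))" if a: "a \<in> W - E" for a
  proof -
    have aU: "a \<in> U - E" using a WU by blast
    have sU: "s a \<in> U - S" using bij_betwE[OF s(1)] aU by blast
    have less: "a < s a" using s(2)[OF aU] .
    have "s a \<in> W" using up[of a "s a"] a sU less by auto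
    moreover have "s a \<notin> A"
    proof
      assume sA: "s a \<in> A"
      consider a0 where "a0 \<in> A" "a0 \<le> a" | "a \<in> J" using a unfolding W_def by blast
      then show False
      proof cases
        case 1
        then have "a0 < s a" using less by simp
        moreover from this have "a0 = s a"
          using A(2) 1 sA unfolding antichain_def by (blast intro: less_imp_le)
        ultimately show False by simp
      next
        case 2
        then have "d < snd (s a)" using less by (auto simp: J_def less_prod_def less_eq_prod_def)
        then show False using A_mem(3)[OF sA] by simp
      qed
    qed
    ultimately show ?thesis using sU by blast
  qed
  have AW: "A \<union> (J \<inter> S) \<subseteq> W" using A_mem(1) by (auto simp: W_def)
  have "card (W - E) \<le> card (W - (A \<union> (J \<inter> S)))"
  proof (rule card_inj_on_le)
    show "inj_on s (W - E)"
      using bij_betw_imp_inj_on[OF s(1)] WU by (auto intro: inj_on_subset)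
  qed (use maps finW in auto)
  also have "\<dots> = card W - card (A \<union> (J \<inter> S))"
    using AW finW by (intro card_Diff_subset) (auto intro: finite_subset)
  finally have "card (W - E) \<le> card W - card (A \<union> (J \<inter> S))" .
  moreover have "card (A \<union> (J \<inter> S)) \<le> card W" using AW finW by (intro card_mono)
  moreover have "card W = card (W - E) + card (W \<inter> E)"
    using finW by (metis card_Diff_subset_Int card_mono finite_Int inf_le1 le_add_diff_inverse2)
  ultimately have "card (A \<union> (J \<inter> S)) \<le> card (W \<inter> E)" by linarith
  moreover have "card (A \<union> (J \<inter> S)) = card A + card (J \<inter> S)"
  proof (rule card_Un_disjoint)
    show "finite A" "finite (J \<inter> S)" using AW finW by (auto intro: finite_subset)
    show "A \<inter> (J \<inter> S) = {}" using A_mem(3) by (fastforce simp: J_def)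
  qed
  moreover have "J \<inter> S = {b \<in> S. d < snd b}" using U(3) by (auto simp: J_def)
  moreover have "card (W \<inter> E) \<le> card {a \<in> E. d < fst a}"
    using W_fst finU U(2) by (intro card_mono) (auto intro: finite_subset)
  ultimately show ?thesis by simp
qed

text \<open>
  The partial sums \<open>m\<^sub>1 + \<dots> + m\<^sub>k\<^sub>-\<^sub>1\<close>. A chain from \<open>(i\<^sub>0, j\<^sub>0)\<close> up to \<open>(i\<^sub>1, j\<^sub>1)\<close> costs
  \<open>height m i\<^sub>1 - height m j\<^sub>0\<close>, and the levels of block \<open>d\<close> are those above \<open>height m d\<close> and up to
  \<open>height m (Suc d)\<close>.
\<close>

definition height :: "weight \<Rightarrow> nat \<Rightarrow> nat"
  where "height m k = (\<Sum>d\<in>{1..<k}. m d)"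

lemma height_Suc: "1 \<le> d \<Longrightarrow> height m (Suc d) = height m d + m d"
  by (simp add: height_def)

lemma height_1 [simp]: "height m 1 = 0" "height m (Suc 0) = 0"
  by (simp_all add: height_def)

lemma height_mono: "j \<le> k \<Longrightarrow> height m j \<le> height m k"
  unfolding height_def by (intro sum_mono2) auto

lemma sum_height:
  assumes "finite E" "\<And>a. a \<in> E \<Longrightarrow> f a \<le> n"
  shows "(\<Sum>a\<in>E. height m (f a)) = (\<Sum>d\<in>{1..<n}. m d * card {a \<in> E. d < f a})"
proof -
  have "height m (f a) = (\<Sum>d\<in>{1..<n}. if d < f a then m d else 0)" if "a \<in> E" for a
  proof -
    have "{d \<in> {1..<n}. d < f a} = {1..<f a}" using assms(2)[OF that] by auto
    then show ?thesis
      unfolding height_def by (subst sum.inter_filter[symmetric]) simp_all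
  qed
  then have "(\<Sum>a\<in>E. height m (f a)) = (\<Sum>a\<in>E. \<Sum>d\<in>{1..<n}. if d < f a then m d else 0)"
    by simp
  also have "\<dots> = (\<Sum>d\<in>{1..<n}. \<Sum>a\<in>E. if d < f a then m d else 0)"
    by (rule sum.swap)
  also have "\<dots> = (\<Sum>d\<in>{1..<n}. m d * card {a \<in> E. d < f a})"
    using assms(1) by (intro sum.cong refl) (simp add: sum.inter_filter[symmetric])
  finally show ?thesis .
qed

text \<open>
  The cost of a family of chains splits over \<open>d\<close>, and \<open>antichain_cut\<close> applies for every \<open>d\<close>
  separately, to an antichain of maximal size in \<open>U \<inter> P\<^sub>d\<close>.
\<close>

lemma chain_cover_cost:
  assumes U: "U \<subseteq> root_poset n" "E \<subseteq> U" "S \<subseteq> U"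
    and s: "bij_betw s (U - E) (U - S)" "\<And>a. a \<in> U - E \<Longrightarrow> a < s a"
  shows "(\<Sum>d\<in>{1..<n}. m d * width (U \<inter> subposet n d)) + (\<Sum>b\<in>S. height m (snd b))
    \<le> (\<Sum>a\<in>E. height m (fst a))"
proof -
  have fin: "finite U" "finite E" "finite S"
    using U by (meson finite_root_poset finite_subset)+
  have "m d * width (U \<inter> subposet n d) + m d * card {b \<in> S. d < snd b}
      \<le> m d * card {a \<in> E. d < fst a}" for d
  proof -
    obtain A where A: "A \<subseteq> U \<inter> subposet n d" "antichain A" "card A = width (U \<inter> subposet n d)"
      using width_attained[of "U \<inter> subposet n d"] fin by auto
    have "card A + card {b \<in> S. d < snd b} \<le> card {a \<in> E. d < fst a}"
      by (rule antichain_cut[where n = n and U = U and s = s]) (use U s A(1,2) in auto)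
    then have "m d * (card A + card {b \<in> S. d < snd b}) \<le> m d * card {a \<in> E. d < fst a}"
      by (rule mult_le_mono2)
    then show ?thesis unfolding A(3) by (simp only: distrib_left)
  qed
  then have "(\<Sum>d\<in>{1..<n}. m d * width (U \<inter> subposet n d) + m d * card {b \<in> S. d < snd b})
      \<le> (\<Sum>d\<in>{1..<n}. m d * card {a \<in> E. d < fst a})"
    by (intro sum_mono)
  moreover have "(\<Sum>a\<in>E. height m (fst a)) = (\<Sum>d\<in>{1..<n}. m d * card {a \<in> E. d < fst a})"
    using U fin by (intro sum_height) (auto simp: root_poset_def)
  moreover have "(\<Sum>b\<in>S. height m (snd b)) = (\<Sum>d\<in>{1..<n}. m d * card {b \<in> S. d < snd b})"
    using U fin by (intro sum_height) (auto simp: root_poset_def)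
  ultimately show ?thesis by (simp add: sum.distrib)
qed

section \<open>Decomposing integer points\<close>

text \<open>
  Each level \<open>t\<close> in block \<open>d\<close> contributes the set of elements \<open>a\<close> with \<open>p a < t \<le> q a\<close>. It is an
  antichain because \<open>a < b\<close> forces \<open>q a \<le> p b\<close>, and it lies in \<open>P\<^sub>d\<close> because the bounds on \<open>p\<close> and \<open>q\<close>
  place block \<open>d\<close> between the heights of the two coordinates. Double counting gives the estimate.
\<close>

lemma level_antichains:
  fixes p q :: "nat \<times> nat \<Rightarrow> int"
  assumes p: "\<And>a. a \<in> root_poset n \<Longrightarrow> int (height m (snd a)) \<le> p a"
    and q: "\<And>a. a \<in> root_poset n \<Longrightarrow> q a \<le> int (height m (fst a))"
    and pq: "\<And>a b. a \<in> root_poset n \<Longrightarrow> b \<in> root_poset n \<Longrightarrow> a < b \<Longrightarrow> q a \<le> p b"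
    and T: "T \<subseteq> {int (height m d)<..int (height m (Suc d))}"
    and P': "P' \<subseteq> root_poset n"
  shows "(\<Sum>a\<in>P'. card (T \<inter> {p a<..q a})) \<le> card T * width (P' \<inter> subposet n d)"
proof -
  have fin: "finite T" "finite P'"
    using T P' by (auto intro: finite_subset)
  define A where "A t = {a \<in> P'. p a < t \<and> t \<le> q a}" for t
  have "card (A t) \<le> width (P' \<inter> subposet n d)" if t: "t \<in> T" for t
  proof (rule card_antichain_le_width)
    show "A t \<subseteq> P' \<inter> subposet n d"
    proof
      fix a assume a: "a \<in> A t"
      then have aP: "a \<in> root_poset n" using P' by (auto simp: A_def)
      have "int (height m d) < int (height m (fst a))"
        using a t T q[OF aP] by (auto simp: A_def)
      then have "d < fst a" using height_mono[of "fst a" d m] by linarith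
      moreover have "int (height m (snd a)) < int (height m (Suc d))"
        using a t T p[OF aP] by (fastforce simp: A_def)
      then have "snd a \<le> d" using height_mono[of "Suc d" "snd a" m] by linarith
      ultimately show "a \<in> P' \<inter> subposet n d"
        using a aP by (auto simp: A_def subposet_def)
    qed
    show "antichain (A t)"
      unfolding antichain_def
    proof (intro ballI impI, rule ccontr)
      fix a b assume ab: "a \<in> A t" "b \<in> A t" "a \<le> b" "a \<noteq> b"
      then have "q a \<le> p b" using P' by (intro pq) (auto simp: A_def)
      then show False using ab by (auto simp: A_def)
    qed
  qed (use fin in auto)
  then have "(\<Sum>t\<in>T. card (A t)) \<le> card T * width (P' \<inter> subposet n d)"
    using sum_bounded_above[of T "\<lambda>t. card (A t)"] by simp
  moreover have "(\<Sum>a\<in>P'. card (T \<inter> {p a<..q a})) = (\<Sum>t\<in>T. card (A t))"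
  proof -
    have "card (T \<inter> {p a<..q a}) = (\<Sum>t\<in>T. if p a < t \<and> t \<le> q a then 1 else 0)" for a
    proof -
      have eq: "T \<inter> {p a<..q a} = {t \<in> T. p a < t \<and> t \<le> q a}" by auto
      show ?thesis unfolding eq using fin(1) by (simp flip: sum.inter_filter)
    qed
    then have "(\<Sum>a\<in>P'. card (T \<inter> {p a<..q a}))
        = (\<Sum>a\<in>P'. \<Sum>t\<in>T. if p a < t \<and> t \<le> q a then 1 else 0)" by simp
    also have "\<dots> = (\<Sum>t\<in>T. \<Sum>a\<in>P'. if p a < t \<and> t \<le> q a then 1 else 0)"
      by (rule sum.swap)
    also have "\<dots> = (\<Sum>t\<in>T. card (A t))"
      unfolding A_def using fin(2) by (simp flip: sum.inter_filter)
    finally show ?thesis .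
  qed
  ultimately show ?thesis by simp
qed

lemma card_levels:
  fixes T :: "int set"
  assumes "finite T" "1 \<le> k"
  shows "(\<Sum>d\<in>{1..<k}. card (T \<inter> {int (height m d)<..int (height m (Suc d))}))
    = card (T \<inter> {0<..int (height m k)})"
  using assms(2)
proof (induction k rule: dec_induct)
  case base
  then show ?case by simp
next
  case (step k)
  have "T \<inter> {0<..int (height m (Suc k))}
      = T \<inter> {0<..int (height m k)} \<union> T \<inter> {int (height m k)<..int (height m (Suc k))}"
    using height_mono[of k "Suc k" m] by auto
  moreover have "card \<dots> = card (T \<inter> {0<..int (height m k)})
      + card (T \<inter> {int (height m k)<..int (height m (Suc k))})"
    using assms(1) by (intro card_Un_disjoint) auto
  ultimately show ?case using step by simp
qed

lemma sum_lower_part: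
  fixes z :: "'a \<Rightarrow> nat"
  assumes "finite P" "k \<le> sum z P"
  shows "\<exists>w. (\<forall>a. w a \<le> z a) \<and> sum w P = k"
  using assms(2)
proof (induction k)
  case 0
  show ?case by (rule exI[of _ "\<lambda>_. 0"]) simp
next
  case (Suc k)
  then obtain w where w: "\<forall>a. w a \<le> z a" "sum w P = k" by auto
  have "\<exists>a\<in>P. w a < z a"
  proof (rule ccontr)
    assume "\<not> ?thesis"
    then have "sum z P \<le> sum w P" by (intro sum_mono) (auto simp: not_less)
    then show False using w Suc by simp
  qed
  then obtain a where a: "a \<in> P" "w a < z a" by blast
  have "sum (w(a := Suc (w a))) P = Suc k"
    using w(2) a(1) assms(1) by (simp add: sum.remove[of P a])
  then show ?case using w a by (intro exI[of _ "w(a := Suc (w a))"]) auto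
qed

definition width_bounded :: "nat \<Rightarrow> weight \<Rightarrow> nat \<Rightarrow> (nat \<times> nat \<Rightarrow> nat) \<Rightarrow> bool"
  where "width_bounded n m M x \<longleftrightarrow> (\<forall>P'. P' \<subseteq> root_poset n \<longrightarrow>
    sum x P' \<le> M + (\<Sum>d\<in>{1..<n}. m d * width (P' \<inter> subposet n d)))"

text \<open>
  The hypothesis is used for a single subset, the set \<open>U\<close> covered by an optimal family of chains:
  the optimal cost is then at least the total of \<open>x\<close> minus \<open>M\<close>.
\<close>

lemma width_bounded_potential:
  assumes "width_bounded n m M x"
  obtains p q :: "nat \<times> nat \<Rightarrow> int" where
    "\<And>a. a \<in> root_poset n \<Longrightarrow> int (height m (snd a)) \<le> p a"
    "\<And>a. a \<in> root_poset n \<Longrightarrow> q a \<le> int (height m (fst a))"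
    "\<And>a. a \<in> root_poset n \<Longrightarrow> q a - p a \<le> int (x a)"
    "\<And>a b. a \<in> root_poset n \<Longrightarrow> b \<in> root_poset n \<Longrightarrow> a < b \<Longrightarrow> q a \<le> p b"
    "int (sum x (root_poset n)) - int M \<le> (\<Sum>a\<in>root_poset n. q a - p a)"
proof -
  let ?P = "root_poset n"
  obtain p q :: "nat \<times> nat \<Rightarrow> int" and U E S s where
    pq: "\<And>a. a \<in> ?P \<Longrightarrow> int (height m (snd a)) \<le> p a"
      "\<And>a. a \<in> ?P \<Longrightarrow> q a \<le> int (height m (fst a))"
      "\<And>a. a \<in> ?P \<Longrightarrow> q a - p a \<le> int (x a)"
      "\<And>a b. a \<in> ?P \<Longrightarrow> b \<in> ?P \<Longrightarrow> a < b \<Longrightarrow> q a \<le> p b"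
    and U: "U \<subseteq> ?P" "E \<subseteq> U" "S \<subseteq> U"
    and s: "bij_betw s (U - E) (U - S)" "\<And>a. a \<in> U - E \<Longrightarrow> a < s a"
    and obj: "(\<Sum>a\<in>?P - U. int (x a)) + (\<Sum>a\<in>E. int (height m (fst a)))
        - (\<Sum>b\<in>S. int (height m (snd b))) \<le> (\<Sum>a\<in>?P. q a - p a)"
    by (rule poset_potential_duality[OF finite_root_poset,
          where lo = "\<lambda>a. int (height m (snd a))"
          and hi = "\<lambda>a. int (height m (fst a))" and x = "\<lambda>a. int (x a)"]) (rule that; assumption)
  have "sum x U \<le> M + (\<Sum>d\<in>{1..<n}. m d * width (U \<inter> subposet n d))"
    using assms U(1) by (simp add: width_bounded_def)
  then have "sum x U + (\<Sum>b\<in>S. height m (snd b)) \<le> M + (\<Sum>a\<in>E. height m (fst a))"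
    using chain_cover_cost[OF U s, of m] by linarith
  then have "(\<Sum>a\<in>U. int (x a)) + (\<Sum>b\<in>S. int (height m (snd b)))
      \<le> int M + (\<Sum>a\<in>E. int (height m (fst a)))"
    by (simp flip: of_nat_sum of_nat_add)
  moreover have "(\<Sum>a\<in>?P. int (x a)) = (\<Sum>a\<in>?P - U. int (x a)) + (\<Sum>a\<in>U. int (x a))"
    using U(1) by (intro sum.subset_diff) auto
  ultimately have total: "int (sum x ?P) - int M \<le> (\<Sum>a\<in>?P. q a - p a)"
    using obj by simp
  show ?thesis
  proof (rule that[of p q])
    show "int (height m (snd a)) \<le> p a" if "a \<in> ?P" for a by (rule pq(1)[OF that])
    show "q a \<le> int (height m (fst a))" if "a \<in> ?P" for a by (rule pq(2)[OF that])
    show "q a - p a \<le> int (x a)" if "a \<in> ?P" for a by (rule pq(3)[OF that])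
    show "q a \<le> p b" if "a \<in> ?P" "b \<in> ?P" "a < b" for a b by (rule pq(4)[OF that])
  qed (fact total)
qed

text \<open>
  Take a potential for the combined weight and cut each block of levels, of length \<open>m d + m' d\<close>, into
  its lowest \<open>m d\<close> levels and the remaining \<open>m' d\<close>. The two groups of antichains give \<open>y\<close> and \<open>y'\<close>,
  and the at most \<open>M + M'\<close> units of \<open>x\<close> left over are divided in any way that respects \<open>M\<close> and \<open>M'\<close>.
\<close>

lemma width_bounded_split:
  assumes x: "width_bounded n (\<lambda>d. m d + m' d) (M + M') x"
  shows "\<exists>y y'. (\<forall>a\<in>root_poset n. x a = y a + y' a) \<and>
    width_bounded n m M y \<and> width_bounded n m' M' y'"
proof -
  let ?P = "root_poset n"
  define H where "H = height (\<lambda>d. m d + m' d)"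
  obtain p q :: "nat \<times> nat \<Rightarrow> int" where
    p: "\<And>a. a \<in> ?P \<Longrightarrow> int (H (snd a)) \<le> p a" and
    q: "\<And>a. a \<in> ?P \<Longrightarrow> q a \<le> int (H (fst a))" and
    qp: "\<And>a. a \<in> ?P \<Longrightarrow> q a - p a \<le> int (x a)" and
    pq: "\<And>a b. a \<in> ?P \<Longrightarrow> b \<in> ?P \<Longrightarrow> a < b \<Longrightarrow> q a \<le> p b" and
    obj: "int (sum x ?P) - int (M + M') \<le> (\<Sum>a\<in>?P. q a - p a)"
    by (rule width_bounded_potential[OF x, folded H_def]) (rule that; assumption)
  define T where "T d = {int (H d)<..int (H d + m d)}" for d
  define T' where "T' d = {int (H d + m d)<..int (H (Suc d))}" for d
  have H_Suc: "H (Suc d) = H d + m d + m' d" if "d \<in> {1..<n}" for d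
    using that by (simp add: H_def height_Suc)
  define y where "y a = (\<Sum>d\<in>{1..<n}. card (T d \<inter> {p a<..q a}))" for a
  define y' where "y' a = (\<Sum>d\<in>{1..<n}. card (T' d \<inter> {p a<..q a}))" for a
  have y_bound: "sum y P' \<le> (\<Sum>d\<in>{1..<n}. m d * width (P' \<inter> subposet n d))"
    if P': "P' \<subseteq> ?P" for P'
  proof -
    have "sum y P' = (\<Sum>d\<in>{1..<n}. \<Sum>a\<in>P'. card (T d \<inter> {p a<..q a}))"
      unfolding y_def by (rule sum.swap)
    also have "\<dots> \<le> (\<Sum>d\<in>{1..<n}. card (T d) * width (P' \<inter> subposet n d))"
      using p q pq P' H_Suc
      by (intro sum_mono level_antichains[where m = "\<lambda>d. m d + m' d"])
        (auto simp: T_def H_def[symmetric])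
    finally show ?thesis by (simp add: T_def)
  qed
  have y'_bound: "sum y' P' \<le> (\<Sum>d\<in>{1..<n}. m' d * width (P' \<inter> subposet n d))"
    if P': "P' \<subseteq> ?P" for P'
  proof -
    have "sum y' P' = (\<Sum>d\<in>{1..<n}. \<Sum>a\<in>P'. card (T' d \<inter> {p a<..q a}))"
      unfolding y'_def by (rule sum.swap)
    also have "\<dots> \<le> (\<Sum>d\<in>{1..<n}. card (T' d) * width (P' \<inter> subposet n d))"
      using p q pq P'
      by (intro sum_mono level_antichains[where m = "\<lambda>d. m d + m' d"])
        (auto simp: T'_def H_def[symmetric])
    also have "\<dots> = (\<Sum>d\<in>{1..<n}. m' d * width (P' \<inter> subposet n d))"
      by (intro sum.cong refl) (simp add: T'_def H_Suc)
    finally show ?thesis .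
  qed
  \<comment> \<open>The interval of levels of \<open>a\<close> may be empty: \<open>q a < p a\<close> is possible, and then \<open>y\<close> and \<open>y'\<close>
    vanish at \<open>a\<close>, which only lowers the number of left over units.\<close>
  have yy': "y a + y' a = nat (q a - p a)" if a: "a \<in> ?P" for a
  proof -
    have n: "1 \<le> n" "fst a \<le> n" using a by (auto simp: root_poset_def)
    have "y a + y' a = (\<Sum>d\<in>{1..<n}. card ({p a<..q a} \<inter> {int (H d)<..int (H (Suc d))}))"
      unfolding y_def y'_def sum.distrib[symmetric]
    proof (rule sum.cong[OF refl])
      fix d assume d: "d \<in> {1..<n}"
      have "{p a<..q a} \<inter> {int (H d)<..int (H (Suc d))}
          = T d \<inter> {p a<..q a} \<union> T' d \<inter> {p a<..q a}"
        using H_Suc[OF d] by (auto simp: T_def T'_def)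
      moreover have "card \<dots> = card (T d \<inter> {p a<..q a}) + card (T' d \<inter> {p a<..q a})"
        by (intro card_Un_disjoint) (auto simp: T_def T'_def)
      ultimately show "card (T d \<inter> {p a<..q a}) + card (T' d \<inter> {p a<..q a})
          = card ({p a<..q a} \<inter> {int (H d)<..int (H (Suc d))})" by simp
    qed
    also have "\<dots> = card ({p a<..q a} \<inter> {0<..int (H n)})"
      unfolding H_def using n by (intro card_levels) auto
    also have "{p a<..q a} \<inter> {0<..int (H n)} = {p a<..q a}"
    proof -
      have "0 \<le> p a" using p[OF a] by linarith
      moreover have "q a \<le> int (H n)"
        using q[OF a] height_mono[OF n(2), of "\<lambda>d. m d + m' d"] by (simp add: H_def)
      ultimately show ?thesis by auto
    qed
    finally show ?thesis by simp
  qed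
  define z where "z a = x a - (y a + y' a)" for a
  have le: "y a + y' a \<le> x a" if "a \<in> ?P" for a
    using yy'[OF that] qp[OF that] by simp
  have "int (sum z ?P) = (\<Sum>a\<in>?P. int (x a) - int (y a + y' a))"
    using le by (simp add: z_def of_nat_diff del: of_nat_add)
  also have "\<dots> \<le> (\<Sum>a\<in>?P. int (x a) - (q a - p a))"
    by (intro sum_mono) (simp add: yy')
  also have "\<dots> \<le> int (M + M')" using obj by (simp add: sum_subtractf)
  finally have z: "sum z ?P \<le> M + M'" by linarith
  obtain w where w: "\<And>a. w a \<le> z a" "sum w ?P = min M (sum z ?P)"
    using sum_lower_part[OF finite_root_poset, of "min M (sum z ?P)" z n] by auto
  have "int (\<Sum>a\<in>?P. z a - w a) = int (sum z ?P) - int (sum w ?P)"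
    using w(1) by (simp add: of_nat_diff sum_subtractf)
  then have zw: "(\<Sum>a\<in>?P. z a - w a) \<le> M'" using z w(2) by linarith
  show ?thesis
  proof (rule exI[of _ "\<lambda>a. y a + w a"], rule exI[of _ "\<lambda>a. y' a + (z a - w a)"],
      intro conjI ballI)
    show "x a = y a + w a + (y' a + (z a - w a))" if "a \<in> ?P" for a
      using le[OF that] w(1)[of a] by (simp add: z_def)
    show "width_bounded n m M (\<lambda>a. y a + w a)"
      unfolding width_bounded_def
    proof (intro allI impI)
      fix P' assume P': "P' \<subseteq> ?P"
      have "sum w P' \<le> sum w ?P" using P' by (intro sum_mono2) auto
      then show "(\<Sum>a\<in>P'. y a + w a) \<le> M + (\<Sum>d\<in>{1..<n}. m d * width (P' \<inter> subposet n d))"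
        using y_bound[OF P'] w(2) by (simp add: sum.distrib)
    qed
    show "width_bounded n m' M' (\<lambda>a. y' a + (z a - w a))"
      unfolding width_bounded_def
    proof (intro allI impI)
      fix P' assume P': "P' \<subseteq> ?P"
      have "(\<Sum>a\<in>P'. z a - w a) \<le> (\<Sum>a\<in>?P. z a - w a)" using P' by (intro sum_mono2) auto
      then show "(\<Sum>a\<in>P'. y' a + (z a - w a))
          \<le> M' + (\<Sum>d\<in>{1..<n}. m' d * width (P' \<inter> subposet n d))"
        using y'_bound[OF P'] zw by (simp add: sum.distrib)
    qed
  qed
qed

section \<open>From integer points to the polytopes\<close>

lemma width_bounded_mem_integer_points:
  assumes "width_bounded n m M z"
  shows "(\<lambda>a. if a \<in> root_poset n then real (z a) else 0) \<in> integer_points_S n m M"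
proof -
  have "(\<Sum>a\<in>P'. if a \<in> root_poset n then real (z a) else 0)
      \<le> real M + (\<Sum>d\<in>{1..<n}. real (m d) * real (width (P' \<inter> subposet n d)))"
    if P': "P' \<subseteq> root_poset n" for P'
  proof -
    have "(\<Sum>a\<in>P'. if a \<in> root_poset n then real (z a) else 0) = real (sum z P')"
      unfolding of_nat_sum using P' by (intro sum.cong) auto
    also have "\<dots> \<le> real (M + (\<Sum>d\<in>{1..<n}. m d * width (P' \<inter> subposet n d)))"
      using assms P' unfolding width_bounded_def of_nat_le_iff by blast
    finally show ?thesis by simp
  qed
  then show ?thesis
    by (auto simp: integer_points_S_def polytope_X_def coord_space_def)
qed

lemma integer_points_add_superset:
  "integer_points_S n (m + m') (M + M') \<subseteq> integer_points_S n m M + integer_points_S n m' M'"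
proof
  fix x assume x: "x \<in> integer_points_S n (m + m') (M + M')"
  define z where "z a = nat \<lfloor>x a\<rfloor>" for a
  have xz: "x a = real (z a)" if "a \<in> root_poset n" for a
    using x that by (auto simp: z_def integer_points_S_def polytope_X_def elim!: Ints_cases)
  have x0: "x a = 0" if "a \<notin> root_poset n" for a
    using x that unfolding integer_points_S_def polytope_X_def coord_space_def by blast
  have "width_bounded n (\<lambda>d. m d + m' d) (M + M') z"
    unfolding width_bounded_def
  proof (intro allI impI)
    fix P' assume P': "P' \<subseteq> root_poset n"
    have "real (sum z P') = sum x P'" using xz P' by (auto intro!: sum.cong)
    also have "\<dots> \<le> real (M + M')
        + (\<Sum>d\<in>{1..<n}. real ((m + m') d) * real (width (P' \<inter> subposet n d)))"
      using x P' by (auto simp: integer_points_S_def polytope_X_def)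
    also have "\<dots> = real (M + M' + (\<Sum>d\<in>{1..<n}. (m d + m' d) * width (P' \<inter> subposet n d)))"
      by simp
    finally show "sum z P' \<le> M + M' + (\<Sum>d\<in>{1..<n}. (m d + m' d) * width (P' \<inter> subposet n d))"
      by (simp only: of_nat_le_iff)
  qed
  then obtain y y' where y: "\<And>a. a \<in> root_poset n \<Longrightarrow> z a = y a + y' a"
    "width_bounded n m M y" "width_bounded n m' M' y'"
    using width_bounded_split by blast
  let ?r = "\<lambda>y a. if a \<in> root_poset n then real (y a) else 0"
  have "x = ?r y + ?r y'" using y(1) xz x0 by (auto simp: fun_eq_iff)
  then show "x \<in> integer_points_S n m M + integer_points_S n m' M'"
    using y(2,3) width_bounded_mem_integer_points by (auto intro: set_plus_intro)
qed

lemma polytope_add_mem: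
  assumes "x \<in> polytope_X n m M" "x' \<in> polytope_X n m' M'"
  shows "x + x' \<in> polytope_X n (m + m') (M + M')"
proof -
  have "(\<Sum>a\<in>P'. (x + x') a)
      \<le> real (M + M') + (\<Sum>d\<in>{1..<n}. real ((m + m') d) * real (width (P' \<inter> subposet n d)))"
    if P': "P' \<subseteq> root_poset n" for P'
  proof -
    have "sum x P' + sum x' P'
        \<le> (real M + (\<Sum>d\<in>{1..<n}. real (m d) * real (width (P' \<inter> subposet n d))))
        + (real M' + (\<Sum>d\<in>{1..<n}. real (m' d) * real (width (P' \<inter> subposet n d))))"
      using assms P' by (intro add_mono) (auto simp: polytope_X_def)
    then show ?thesis by (simp add: sum.distrib distrib_right)
  qed
  then show ?thesis using assms by (auto simp: polytope_X_def coord_space_def)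
qed

lemma integer_points_add_mem:
  assumes "x \<in> integer_points_S n m M" "x' \<in> integer_points_S n m' M'"
  shows "x + x' \<in> integer_points_S n (m + m') (M + M')"
  using assms polytope_add_mem by (auto simp: integer_points_S_def)

text \<open>Bolzano and Weierstrass for finitely many bounded real sequences at once.\<close>

lemma finite_convergent_subsequence:
  fixes f :: "nat \<Rightarrow> 'i \<Rightarrow> real"
  assumes "finite A" "\<And>i. i \<in> A \<Longrightarrow> Bseq (\<lambda>k. f k i)"
  shows "\<exists>r. strict_mono r \<and> (\<forall>i\<in>A. convergent (\<lambda>k. f (r k) i))"
  using assms
proof (induction A rule: finite_induct)
  case empty
  show ?case by (rule exI[of _ id]) (simp add: strict_mono_def)
next
  case (insert i A)
  then obtain r where r: "strict_mono (r :: nat \<Rightarrow> nat)" "\<forall>j\<in>A. convergent (\<lambda>k. f (r k) j)" by auto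
  obtain s where s: "strict_mono (s :: nat \<Rightarrow> nat)" "monoseq (\<lambda>k. f (r (s k)) i)"
    using seq_monosub[of "\<lambda>k. f (r k) i"] by auto
  have rs: "strict_mono (r \<circ> s)" using r s by (auto simp: strict_mono_def)
  have "Bseq (\<lambda>k. f (r (s k)) i)"
    using Bseq_subseq[of "\<lambda>k. f k i" "r \<circ> s"] insert.prems[of i] by simp
  then have "convergent (\<lambda>k. f (r (s k)) i)" using s(2) by (rule Bseq_monoseq_convergent)
  moreover have "convergent (\<lambda>k. f (r (s k)) j)" if "j \<in> A" for j
    using convergent_subseq_convergent[of "\<lambda>k. f (r k) j" s] r s that by (auto simp: o_def)
  ultimately have "\<forall>j\<in>insert i A. convergent (\<lambda>k. f ((r \<circ> s) k) j)" by simp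
  then show ?case using rs by blast
qed

text \<open>
  The inequalities are homogeneous in the point, the weight and \<open>M\<close>, and they survive limits. The
  indices \<open>r k\<close> allow passing to a subsequence.
\<close>

lemma rescaled_limit_mem_polytope:
  fixes y :: "nat \<Rightarrow> nat \<times> nat \<Rightarrow> nat"
  assumes y: "\<And>k. width_bounded n (\<lambda>d. Suc (r k) * m d) (Suc (r k) * M) (y k)"
    and lim: "\<And>a. a \<in> root_poset n \<Longrightarrow> (\<lambda>k. real (y k a) / real (Suc (r k))) \<longlonglongrightarrow> l a"
    and l0: "\<And>a. a \<notin> root_poset n \<Longrightarrow> l a = 0"
  shows "l \<in> polytope_X n m M"
proof -
  have "0 \<le> l a" if "a \<in> root_poset n" for a
    by (rule LIMSEQ_le_const[OF lim[OF that]]) simp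
  moreover have "sum l P' \<le> real M + (\<Sum>d\<in>{1..<n}. real (m d) * real (width (P' \<inter> subposet n d)))"
    (is "_ \<le> ?B") if P': "P' \<subseteq> root_poset n" for P'
  proof (rule LIMSEQ_le_const2)
    show "(\<lambda>k. \<Sum>a\<in>P'. real (y k a) / real (Suc (r k))) \<longlonglongrightarrow> sum l P'"
      using P' by (intro tendsto_sum lim) auto
    have "(\<Sum>a\<in>P'. real (y k a) / real (Suc (r k))) \<le> ?B" for k
    proof -
      have "sum (y k) P' \<le> Suc (r k) * M
          + (\<Sum>d\<in>{1..<n}. Suc (r k) * m d * width (P' \<inter> subposet n d))"
        using y[of k] P' by (simp add: width_bounded_def)
      also have "\<dots> = Suc (r k) * (M + (\<Sum>d\<in>{1..<n}. m d * width (P' \<inter> subposet n d)))"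
        by (simp only: distrib_left sum_distrib_left mult.assoc)
      finally have "real (sum (y k) P') \<le> real (Suc (r k) * (M + (\<Sum>d\<in>{1..<n}. m d * width (P' \<inter> subposet n d))))"
        by (simp only: of_nat_le_iff)
      also have "\<dots> = ?B * real (Suc (r k))"
        by (simp only: of_nat_mult of_nat_add of_nat_sum mult.commute)
      finally have "real (sum (y k) P') / real (Suc (r k)) \<le> ?B"
        by (simp only: pos_divide_le_eq of_nat_0_less_iff zero_less_Suc)
      then show ?thesis by (simp add: sum_divide_distrib)
    qed
    then show "\<exists>N. \<forall>k\<ge>N. (\<Sum>a\<in>P'. real (y k a) / real (Suc (r k))) \<le> ?B" by blast
  qed
  ultimately show ?thesis using l0 by (auto simp: polytope_X_def coord_space_def)
qed

text \<open>
  The integer parts \<open>z k\<close> of \<open>Suc k * x\<close> satisfy the inequalities for the weights and bounds scaled by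
  \<open>Suc k\<close>, so they split. The rescaled first parts lie between \<open>0\<close> and \<open>x\<close>, hence converge along a
  subsequence; the second parts then converge to the difference.
\<close>

lemma polytope_add_superset:
  "polytope_X n (m + m') (M + M') \<subseteq> polytope_X n m M + polytope_X n m' M'"
proof
  fix x assume x: "x \<in> polytope_X n (m + m') (M + M')"
  let ?P = "root_poset n"
  have nonneg: "0 \<le> x a" if "a \<in> ?P" for a using x that by (auto simp: polytope_X_def)
  have x0: "x a = 0" if "a \<notin> ?P" for a
    using x that unfolding polytope_X_def coord_space_def by blast
  define z where "z k a = nat \<lfloor>real (Suc k) * x a\<rfloor>" for k a
  have z_le: "real (z k a) \<le> real (Suc k) * x a" if "a \<in> ?P" for k a
    unfolding z_def using nonneg[OF that] by (intro of_nat_floor) auto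
  have z_ge: "real (Suc k) * x a - 1 \<le> real (z k a)" for k a
    unfolding z_def by linarith
  have "width_bounded n (\<lambda>d. Suc k * m d + Suc k * m' d) (Suc k * M + Suc k * M') (z k)" for k
    unfolding width_bounded_def
  proof (intro allI impI)
    fix P' assume P': "P' \<subseteq> ?P"
    have "real (sum (z k) P') \<le> (\<Sum>a\<in>P'. real (Suc k) * x a)"
      unfolding of_nat_sum using P' by (intro sum_mono z_le) auto
    also have "\<dots> = real (Suc k) * sum x P'" by (simp only: sum_distrib_left)
    also have "\<dots> \<le> real (Suc k) * (real (M + M')
        + (\<Sum>d\<in>{1..<n}. real ((m + m') d) * real (width (P' \<inter> subposet n d))))"
      using x P' by (intro mult_left_mono) (auto simp: polytope_X_def)
    also have "\<dots> = real (Suc k * (M + M' + (\<Sum>d\<in>{1..<n}. (m d + m' d) * width (P' \<inter> subposet n d))))"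
      by (simp only: of_nat_mult of_nat_add of_nat_sum plus_fun_def)
    finally have "sum (z k) P'
        \<le> Suc k * (M + M' + (\<Sum>d\<in>{1..<n}. (m d + m' d) * width (P' \<inter> subposet n d)))"
      by (simp only: of_nat_le_iff)
    also have "\<dots> = Suc k * M + Suc k * M'
        + (\<Sum>d\<in>{1..<n}. (Suc k * m d + Suc k * m' d) * width (P' \<inter> subposet n d))"
      by (simp only: distrib_left distrib_right sum_distrib_left mult.assoc)
    finally show "sum (z k) P' \<le> \<dots>" .
  qed
  then have "\<exists>y y'. (\<forall>a\<in>?P. z k a = y a + y' a) \<and> width_bounded n (\<lambda>d. Suc k * m d) (Suc k * M) y
      \<and> width_bounded n (\<lambda>d. Suc k * m' d) (Suc k * M') y'" for k
    by (rule width_bounded_split)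
  then obtain y y' where yy': "\<And>k a. a \<in> ?P \<Longrightarrow> z k a = y k a + y' k a"
    and y: "\<And>k. width_bounded n (\<lambda>d. Suc k * m d) (Suc k * M) (y k)"
    and y': "\<And>k. width_bounded n (\<lambda>d. Suc k * m' d) (Suc k * M') (y' k)"
    by metis
  define f where "f k a = real (y k a) / real (Suc k)" for k a
  have z_lim: "(\<lambda>k. real (z k a) / real (Suc k)) \<longlonglongrightarrow> x a" if a: "a \<in> ?P" for a
  proof (rule tendsto_sandwich)
    show "\<forall>\<^sub>F k in sequentially. x a + - inverse (real (Suc k)) \<le> real (z k a) / real (Suc k)"
    proof (intro always_eventually allI)
      fix k
      have "x a + - inverse (real (Suc k)) = (real (Suc k) * x a - 1) / real (Suc k)"
        by (simp add: field_simps del: of_nat_Suc)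
      also have "\<dots> \<le> real (z k a) / real (Suc k)"
        by (intro divide_right_mono z_ge) simp
      finally show "x a + - inverse (real (Suc k)) \<le> real (z k a) / real (Suc k)" .
    qed
    show "\<forall>\<^sub>F k in sequentially. real (z k a) / real (Suc k) \<le> x a"
      using z_le[OF a]
      by (intro always_eventually allI)
        (simp only: pos_divide_le_eq of_nat_0_less_iff zero_less_Suc mult.commute)
    show "(\<lambda>k. x a + - inverse (real (Suc k))) \<longlonglongrightarrow> x a"
      by (rule LIMSEQ_inverse_real_of_nat_add_minus)
  qed simp
  have "Bseq (\<lambda>k. f k a)" if a: "a \<in> ?P" for a
  proof (rule BseqI')
    fix k
    have "real (y k a) \<le> real (Suc k) * x a" using z_le[OF a, of k] yy'[OF a, of k] by simp
    then have "f k a \<le> x a"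
      by (simp only: f_def pos_divide_le_eq of_nat_0_less_iff zero_less_Suc mult.commute)
    then show "norm (f k a) \<le> x a" by (simp add: f_def)
  qed
  then obtain r where r: "strict_mono r" "\<forall>a\<in>?P. convergent (\<lambda>k. f (r k) a)"
    using finite_convergent_subsequence[OF finite_root_poset] by blast
  define l where "l a = (if a \<in> ?P then lim (\<lambda>k. f (r k) a) else 0)" for a
  have l: "(\<lambda>k. real (y (r k) a) / real (Suc (r k))) \<longlonglongrightarrow> l a" if "a \<in> ?P" for a
    using r(2) that by (simp add: l_def f_def convergent_LIMSEQ_iff)
  have l': "(\<lambda>k. real (y' (r k) a) / real (Suc (r k))) \<longlonglongrightarrow> (x - l) a" if a: "a \<in> ?P" for a
  proof -
    have "(\<lambda>k. real (z (r k) a) / real (Suc (r k)) - real (y (r k) a) / real (Suc (r k))) \<longlonglongrightarrow> x a - l a"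
      using LIMSEQ_subseq_LIMSEQ[OF z_lim[OF a] r(1)] l[OF a]
      by (intro tendsto_diff) (simp_all add: o_def)
    then show ?thesis by (simp add: yy'[OF a] diff_divide_distrib[symmetric])
  qed
  have "l \<in> polytope_X n m M"
    by (rule rescaled_limit_mem_polytope[OF y l]) (simp_all add: l_def)
  moreover have "x - l \<in> polytope_X n m' M'"
    by (rule rescaled_limit_mem_polytope[OF y' l']) (simp_all add: l_def x0)
  moreover have "x = l + (x - l)" by (simp add: fun_eq_iff)
  ultimately show "x \<in> polytope_X n m M + polytope_X n m' M'"
    by (metis set_plus_intro)
qed

theorem theorem2:
  fixes n M M' :: nat and \<mu> \<mu>' :: weight
  assumes "n \<ge> 2"
    and "\<mu> \<in> dominant_weights n" and "\<mu>' \<in> dominant_weights n"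
  shows "integer_points_S n \<mu> M + integer_points_S n \<mu>' M' = integer_points_S n (\<mu> + \<mu>') (M + M')
    \<and> polytope_X n \<mu> M + polytope_X n \<mu>' M' = polytope_X n (\<mu> + \<mu>') (M + M')"
proof
  show "integer_points_S n \<mu> M + integer_points_S n \<mu>' M' = integer_points_S n (\<mu> + \<mu>') (M + M')"
    using integer_points_add_superset by (fastforce elim!: set_plus_elim intro: integer_points_add_mem)
  show "polytope_X n \<mu> M + polytope_X n \<mu>' M' = polytope_X n (\<mu> + \<mu>') (M + M')"
    using polytope_add_superset by (fastforce elim!: set_plus_elim intro: polytope_add_mem)
qed

end
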